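(* Let $n\ge 1$, let $\Phi:\mathbb{R}^n\to\mathbb{R}^n$ be symmetric in its arguments, i.e. $\Phi(P\Lambda)=P\,\Phi(\Lambda)$ for every $n\times n$ permutation matrix $P$ and every $\Lambda\in\mathbb{R}^n$, and assume that $\Phi(\Lambda)=\mathrm{sign}(\Lambda)\odot\Phi(|\Lambda|)$ for all $\Lambda\in\mathbb{R}^n$. Let $F:\mathbb{R}^{n\times n}\to\mathbb{R}^{n\times n}$ be the associated matrix-valued spectral function, $$F(X)=V_X\,\mathrm{diag}(\Phi(\Lambda_X))\,U_X^*,$$ where $X=V_X\,\mathrm{diag}(\Lambda_X)\,U_X^*$ is a singular value decomposition of $X$. Let $X\in\mathbb{R}^{n\times n}$ have distinct singular values, i.e. $(\Lambda_X)_i\neq(\Lambda_X)_j$ for all $i\neq j$. Then $F$ is differentiable at $X$ if and only if $\Phi$ is differentiable at $\Lambda_X$. Moreover, in that case, for every $\delta\in\mathbb{R}^{n\times n}$, the derivative of $F$ at $X$ in the direction $\delta$ is $$\partial F(X)[\delta]=V_X\Big(\mathcal{M}(\Lambda_X)[\bar\delta]+\Gamma_S(\Lambda_X)\odot\mathcal{P}_S(\bar\delta)+\Gamma_A(\Lambda_X)\odot\mathcal{P}_A(\bar\delta)\Big)U_X^*,\qquad \bar\delta=V_X^*\,\delta\,U_X,$$ where, for $Y\in\mathbb{R}^{n\times n}$ and $1\le i,j\le n$, $$\mathcal{P}_S(Y)_{i,j}=\frac{Y_{i,j}+Y_{j,i}}{2},\qquad \mathcal{P}_A(Y)_{i,j}=\frac{Y_{i,j}-Y_{j,i}}{2},$$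 $\mathcal{M}(\Lambda)[Y]$ is the diagonal matrix whose diagonal is the vector $\partial\Phi(\Lambda)[(Y_{1,1},\dots,Y_{n,n})]$, and $$\Gamma_S(\Lambda)_{i,j}=\begin{cases}0&\text{if } i=j,\\ \dfrac{\Phi(\Lambda)_i-\Phi(\Lambda)_j}{\Lambda_i-\Lambda_j}&\text{if } i\ne j \text{ and } \Lambda_i\neq\Lambda_j,\\ \partial\Phi(\Lambda)_{i,i}-\partial\Phi(\Lambda)_{i,j}&\text{otherwise,}\end{cases}$$ $$\Gamma_A(\Lambda)_{i,j}=\begin{cases}0&\text{if } i=j,\\ \dfrac{\Phi(\Lambda)_i+\Phi(\Lambda)_j}{\Lambda_i+\Lambda_j}&\text{if } i\neq j\text{ and } (\Lambda_i>0\text{ or }\Lambda_j>0),\\ \partial\Phi(\Lambda)_{i,i}-\partial\Phi(\Lambda)_{i,j}&\text{otherwise.}\end{cases}$$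
   Context: All matrices are real and $*$ denotes the transpose. A (full) singular value decomposition (SVD) of $X\in\mathbb{R}^{n\times n}$ is $X=V_X\,\mathrm{diag}(\Lambda_X)\,U_X^*$ with $V_X,U_X\in\mathbb{R}^{n\times n}$ orthogonal and $\Lambda_X\in\mathbb{R}^n$ the vector of (nonnegative) singular values; the SVD is in general not unique, and $V_X,\Lambda_X,U_X$ refer to any fixed choice of SVD of $X$. For a vector $\Lambda\in\mathbb{R}^n$, $\mathrm{diag}(\Lambda)$ is the $n\times n$ matrix with diagonal $\Lambda$ and zeros elsewhere. $\odot$ is the entrywise product; $|\Lambda|$ and $\mathrm{sign}(\Lambda)$ are taken entrywise, with $\mathrm{sign}(0)=0$. The condition $\Phi(\Lambda)=\mathrm{sign}(\Lambda)\odot\Phi(|\Lambda|)$ expresses that $\Phi$ is extended from vectors with nonnegative entries to all of $\mathbb{R}^n$ by this formula. With these conditions on $\Phi$, the value $F(X)$ does not depend on the choice of SVD. $\partial\Phi(\Lambda)$ denotes the Jacobian (derivative) of $\Phi$ at $\Lambda$, $\partial\Phi(\Lambda)[v]$ its action on a vector $v\in\mathbb{R}^n$, and $\partial\Phi(\Lambda)_{i,j}$ its $(i,j)$ entry. *)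

theory Defs
  imports "HOL-Analysis.Analysis"
begin

text \<open>
  Conventions: the type \<^typ>\<open>real ^ 'n\<close> stands for vectors of length \<open>n = CARD('n)\<close>, so \<open>n \<ge> 1\<close>
  automatically. On vectors and matrices, \<open>(*)\<close> is the library's entrywise product, whereas
  \<open>(**)\<close> is the matrix product. Both \<^const>\<open>sgn\<close> and the norm on \<^typ>\<open>real ^ 'n\<close> refer to
  the whole vector, hence the entrywise sign and modulus below.
\<close>

definition sign_vec :: "real ^ 'n \<Rightarrow> real ^ 'n" where
  "sign_vec L = (\<chi> i. sgn (L $ i))"

definition abs_vec :: "real ^ 'n \<Rightarrow> real ^ 'n" where
  "abs_vec L = (\<chi> i. \<bar>L $ i\<bar>)"

definition diag :: "real ^ 'n \<Rightarrow> real ^ 'n ^ 'n" where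
  "diag L = (\<chi> i j. if i = j then L $ i else 0)"

definition permutation_matrix :: "real ^ 'n ^ 'n \<Rightarrow> bool" where
  "permutation_matrix P \<longleftrightarrow>
     (\<exists>p. p permutes UNIV \<and> P = (\<chi> i j. if j = p i then 1 else 0))"

definition is_svd :: "real ^ 'n ^ 'n \<Rightarrow> real ^ 'n \<Rightarrow> real ^ 'n ^ 'n \<Rightarrow> real ^ 'n ^ 'n \<Rightarrow> bool" where
  "is_svd V L U X \<longleftrightarrow>
     orthogonal_matrix V \<and> orthogonal_matrix U \<and> (\<forall>i. 0 \<le> L $ i) \<and>
     X = V ** diag L ** transpose U"

text \<open>
  The value is computed from an arbitrary choice of singular value decomposition. For functions
  that are symmetric and sign-equivariant (the only ones of interest) it does not depend
  on this choice.
\<close>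

definition spectral_fun :: "(real ^ 'n \<Rightarrow> real ^ 'n) \<Rightarrow> real ^ 'n ^ 'n \<Rightarrow> real ^ 'n ^ 'n" where
  "spectral_fun \<Phi> X =
     (SOME Y. \<exists>V L U. is_svd V L U X \<and> Y = V ** diag (\<Phi> L) ** transpose U)"

definition P_S :: "real ^ 'n ^ 'n \<Rightarrow> real ^ 'n ^ 'n" where
  "P_S Y = (\<chi> i j. (Y $ i $ j + Y $ j $ i) / 2)"

definition P_A :: "real ^ 'n ^ 'n \<Rightarrow> real ^ 'n ^ 'n" where
  "P_A Y = (\<chi> i j. (Y $ i $ j - Y $ j $ i) / 2)"

definition M_diag :: "(real ^ 'n \<Rightarrow> real ^ 'n) \<Rightarrow> real ^ 'n \<Rightarrow> real ^ 'n ^ 'n \<Rightarrow> real ^ 'n ^ 'n" where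
  "M_diag \<Phi> L Y = diag (frechet_derivative \<Phi> (at L) (\<chi> i. Y $ i $ i))"

definition Gamma_S :: "(real ^ 'n \<Rightarrow> real ^ 'n) \<Rightarrow> real ^ 'n \<Rightarrow> real ^ 'n ^ 'n" where
  "Gamma_S \<Phi> L = (\<chi> i j.
     if i = j then 0
     else if L $ i \<noteq> L $ j then (\<Phi> L $ i - \<Phi> L $ j) / (L $ i - L $ j)
     else jacobian \<Phi> (at L) $ i $ i - jacobian \<Phi> (at L) $ i $ j)"

definition Gamma_A :: "(real ^ 'n \<Rightarrow> real ^ 'n) \<Rightarrow> real ^ 'n \<Rightarrow> real ^ 'n ^ 'n" where
  "Gamma_A \<Phi> L = (\<chi> i j.
     if i = j then 0
     else if L $ i > 0 \<or> L $ j > 0 then (\<Phi> L $ i + \<Phi> L $ j) / (L $ i + L $ j)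
     else jacobian \<Phi> (at L) $ i $ i - jacobian \<Phi> (at L) $ i $ j)"

end

theory Submission
  imports Defs
begin

text \<open>
  If \<open>V ** diag v ** transpose U\<close> is a decomposition with orthogonal factors and \<open>v\<close> of arbitrary
  signs, the spectral function replaces \<open>v\<close> by \<open>\<Phi> v\<close>. Hence \<open>\<Phi>\<close> is the restriction of the spectral
  function to a linear family of matrices, and inherits its differentiability. Conversely, the
  matrices near \<open>X\<close> are parametrized by \<open>M\<close> near \<open>0\<close> as
  \<open>G M = V ** C (A M) ** diag (L + diagonal of M) ** transpose (U ** C (B M))\<close>, where \<open>C\<close> is the Cayley
  transform and the skew matrices \<open>A M\<close>, \<open>B M\<close> are linear in \<open>M\<close>, chosen such that the derivative of
  \<open>G\<close> at \<open>0\<close> is \<open>M \<mapsto> V ** M ** transpose U\<close>; this is possible since the singular values are distinct.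
  The spectral function composed with \<open>G\<close> is explicit and differentiable at \<open>0\<close>, and \<open>G\<close> is locally
  surjective (by Brouwer's theorem) with a right inverse differentiable at \<open>X\<close>.
\<close>

subsection \<open>Matrix algebra\<close>

lemma matrix_add_rdistrib: "(A + B) ** C = A ** C + B ** (C :: real ^ 'n ^ 'm)"
  by (simp add: vec_eq_iff matrix_matrix_mult_def distrib_right sum.distrib)

lemma matrix_sub_ldistrib: "A ** (B - C) = A ** B - A ** (C :: real ^ 'n ^ 'm)"
  by (simp add: vec_eq_iff matrix_matrix_mult_def right_diff_distrib sum_subtractf)

lemma matrix_sub_rdistrib: "(A - B) ** C = A ** C - B ** (C :: real ^ 'n ^ 'm)"
  by (simp add: vec_eq_iff matrix_matrix_mult_def left_diff_distrib sum_subtractf)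

lemma matrix_scaleR_left: "(c *\<^sub>R A) ** B = c *\<^sub>R (A ** (B :: real ^ 'n ^ 'm))"
  by (simp add: vec_eq_iff matrix_matrix_mult_def sum_distrib_left mult.assoc)

lemma matrix_scaleR_right: "A ** (c *\<^sub>R B) = c *\<^sub>R (A ** (B :: real ^ 'n ^ 'm))"
  by (simp add: vec_eq_iff matrix_matrix_mult_def sum_distrib_left mult_ac)

lemma bounded_bilinear_matrix_mult:
  "bounded_bilinear ((**) :: real ^ 'm ^ 'k \<Rightarrow> real ^ 'n ^ 'm \<Rightarrow> real ^ 'n ^ 'k)"
  unfolding bilinear_conv_bounded_bilinear[symmetric] bilinear_def
  by (auto intro!: linearI simp: matrix_add_ldistrib matrix_add_rdistrib
      matrix_scaleR_left matrix_scaleR_right)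

lemma bounded_linear_transpose: "bounded_linear (transpose :: real ^ 'n ^ 'm \<Rightarrow> _)"
  unfolding linear_conv_bounded_linear[symmetric]
  by (auto intro!: linearI simp: transpose_def vec_eq_iff)

lemmas linear_transpose = bounded_linear.linear[OF bounded_linear_transpose]

lemma bounded_linear_diag: "bounded_linear (diag :: real ^ 'n \<Rightarrow> _)"
  unfolding linear_conv_bounded_linear[symmetric]
  by (auto intro!: linearI simp: diag_def vec_eq_iff)

lemma bounded_linear_diagonal: "bounded_linear (\<lambda>M :: real ^ 'n ^ 'n. \<chi> i. M $ i $ i)"
  unfolding linear_conv_bounded_linear[symmetric]
  by (auto intro!: linearI simp: vec_eq_iff)

lemma diag_component: "diag v $ i $ j = (if i = j then v $ i else 0)"
  by (simp add: diag_def)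

lemma matrix_mult_diag [simp]: "(A ** diag v) $ i $ j = A $ i $ j * v $ j"
  by (simp add: matrix_matrix_mult_def diag_def if_distrib[of "\<lambda>x. _ * x"] cong: if_cong)

lemma diag_matrix_mult [simp]: "(diag v ** A) $ i $ j = v $ i * A $ i $ j"
  by (simp add: matrix_matrix_mult_def diag_def if_distrib[of "\<lambda>x. x * _"] cong: if_cong)

lemma transpose_diag [simp]: "transpose (diag v) = diag v"
  by (auto simp: transpose_def diag_def vec_eq_iff)

lemma matrix_inv:
  assumes "invertible A"
  shows "A ** matrix_inv A = mat 1" and "matrix_inv A ** A = mat 1"
  using someI_ex[OF assms[unfolded invertible_def]] unfolding matrix_inv_def by auto

text \<open>Every row has length \<open>1\<close>. Only the independence of \<open>Q\<close> matters
  later: it bounds all Cayley transforms uniformly.\<close>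

lemma norm_orthogonal_matrix:
  fixes Q :: "real ^ 'n ^ 'n"
  assumes "orthogonal_matrix Q"
  shows "norm Q = sqrt (real CARD('n))"
proof -
  have "norm (row i Q) = 1" for i
    using assms by (simp add: orthogonal_matrix_orthonormal_rows)
  then have "norm (Q $ i) = 1" for i
    by (simp add: row_def)
  then show ?thesis
    by (simp add: norm_vec_def L2_set_def)
qed

subsection \<open>The Cayley transform\<close>

text \<open>A rational substitute for the matrix exponential, taking skew matrices to orthogonal
  ones. The factor \<open>1 / 2\<close> makes its derivative at \<open>0\<close> the
  identity.\<close>

definition cayley :: "real ^ 'n ^ 'n \<Rightarrow> real ^ 'n ^ 'n" where
  "cayley A = (mat 1 + (1 / 2) *\<^sub>R A) ** matrix_inv (mat 1 - (1 / 2) *\<^sub>R A)"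

text \<open>The quadratic form of a skew matrix vanishes, so \<open>A *v x = x\<close> forces
  \<open>x \<bullet> x = 0\<close>; an injective square matrix is invertible.\<close>

lemma invertible_one_minus_skew:
  fixes A :: "real ^ 'n ^ 'n"
  assumes "transpose A = - A"
  shows "invertible (mat 1 - A)"
proof -
  have "x = 0" if "(mat 1 - A) *v x = 0" for x
  proof -
    have "A *v x = x"
      using that by (simp add: matrix_vector_mult_diff_rdistrib)
    moreover have "x \<bullet> (A *v x) = - (x \<bullet> (A *v x))"
    proof -
      have "x \<bullet> (A *v x) = (transpose A *v x) \<bullet> x"
        by (simp add: dot_lmul_matrix)
      also have "transpose A *v x = - (A *v x)"
        unfolding assms using matrix_vector_mult_diff_rdistrib[of 0 A x] by simp
      finally show ?thesis by (simp add: inner_commute)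
    qed
    ultimately show "x = 0" by simp
  qed
  then show ?thesis
    using matrix_left_invertible_ker[of "mat 1 - A"] invertible_left_inverse by blast
qed

text \<open>The matrices \<open>P\<close> and \<open>Q\<close> commute, are transposes of each other
  and add up to \<open>2 *\<^sub>R mat 1\<close>. The sum gives the third claim, which expresses the
  inverse of \<open>P\<close> through an orthogonal matrix.\<close>

lemma cayley_mult:
  fixes A :: "real ^ 'n ^ 'n"
  assumes "transpose A = - A"
  shows "cayley A ** (mat 1 - (1 / 2) *\<^sub>R A) = mat 1 + (1 / 2) *\<^sub>R A"
    and "(mat 1 - (1 / 2) *\<^sub>R A) ** cayley A = mat 1 + (1 / 2) *\<^sub>R A"
    and "matrix_inv (mat 1 - (1 / 2) *\<^sub>R A) = (1 / 2) *\<^sub>R (mat 1 + cayley A)"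
    and "orthogonal_matrix (cayley A)"
proof -
  define P where "P = mat 1 - (1 / 2) *\<^sub>R A"
  define Q where "Q = mat 1 + (1 / 2) *\<^sub>R A"
  define R where "R = matrix_inv P"
  have skew: "transpose ((1 / 2) *\<^sub>R A) = - ((1 / 2) *\<^sub>R A)"
    using assms by (simp add: transpose_scalar)
  have "invertible P"
    unfolding P_def by (rule invertible_one_minus_skew[OF skew])
  then have PR: "P ** R = mat 1" and RP: "R ** P = mat 1"
    unfolding R_def by (metis matrix_inv(1), metis matrix_inv(2))
  have C: "cayley A = Q ** R"
    by (simp add: cayley_def P_def Q_def R_def)
  have PQ: "P ** Q = Q ** P"
    by (simp add: P_def Q_def matrix_add_ldistrib matrix_add_rdistrib
        matrix_sub_ldistrib matrix_sub_rdistrib)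
  show *: "cayley A ** (mat 1 - (1 / 2) *\<^sub>R A) = mat 1 + (1 / 2) *\<^sub>R A"
    unfolding C P_def[symmetric] Q_def[symmetric] by (simp add: matrix_mul_assoc[symmetric] RP)
  show PC: "(mat 1 - (1 / 2) *\<^sub>R A) ** cayley A = mat 1 + (1 / 2) *\<^sub>R A"
    unfolding C P_def[symmetric] Q_def[symmetric]
    by (simp add: matrix_mul_assoc PQ) (simp add: matrix_mul_assoc[symmetric] PR)
  have "mat 1 + cayley A = (P + Q) ** R"
    by (simp add: C matrix_add_rdistrib PR)
  also have "P + Q = 2 *\<^sub>R mat 1"
    by (simp add: P_def Q_def scaleR_2)
  finally show "matrix_inv (mat 1 - (1 / 2) *\<^sub>R A) = (1 / 2) *\<^sub>R (mat 1 + cayley A)"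
    by (simp add: matrix_scaleR_left R_def P_def)
  have trans: "transpose P = Q" "transpose Q = P"
    using linear_add[OF linear_transpose, of "mat 1" "(1 / 2) *\<^sub>R A"]
      linear_diff[OF linear_transpose, of "mat 1" "(1 / 2) *\<^sub>R A"] skew
    by (simp_all add: P_def Q_def)
  have "Q ** transpose (cayley A) = P"
    using arg_cong[OF *, of transpose]
    by (simp add: matrix_transpose_mul trans flip: P_def Q_def)
  moreover have "cayley A = R ** Q"
    by (metis C PQ PR RP matrix_mul_assoc matrix_mul_lid matrix_mul_rid)
  ultimately have "cayley A ** transpose (cayley A) = mat 1"
    by (metis RP matrix_mul_assoc)
  then show "orthogonal_matrix (cayley A)"
    by (simp add: orthogonal_matrix matrix_left_right_inverse)
qed

lemma cayley_zero [simp]: "cayley 0 = mat 1"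
proof -
  have "transpose (0 :: real ^ 'n ^ 'n) = - 0"
    by (simp add: transpose_def vec_eq_iff)
  from cayley_mult(1)[OF this] show ?thesis by simp
qed

text \<open>A resolvent identity: multiplying the difference by \<open>P A\<close> on the left and
  \<open>P B\<close> on the right leaves \<open>Q A ** P B - P A ** Q B = A - B\<close>. The
  inverses of \<open>P A\<close> and \<open>P B\<close> are then rewritten through the Cayley
  transforms.\<close>

lemma cayley_diff:
  fixes A B :: "real ^ 'n ^ 'n"
  assumes A: "transpose A = - A" and B: "transpose B = - B"
  shows "cayley A - cayley B = (1 / 4) *\<^sub>R ((mat 1 + cayley A) ** (A - B) ** (mat 1 + cayley B))"
proof -
  define P where "P = (\<lambda>A :: real ^ 'n ^ 'n. mat 1 - (1 / 2) *\<^sub>R A)"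
  define Q where "Q = (\<lambda>A :: real ^ 'n ^ 'n. mat 1 + (1 / 2) *\<^sub>R A)"
  define R where "R = (\<lambda>A :: real ^ 'n ^ 'n. matrix_inv (P A))"
  have inv: "invertible (P C)" if "transpose C = - C" for C
    unfolding P_def using that by (intro invertible_one_minus_skew) (simp add: transpose_scalar)
  have "P A ** (cayley A - cayley B) ** P B = (P A ** cayley A) ** P B - P A ** (cayley B ** P B)"
    by (simp add: matrix_sub_ldistrib matrix_sub_rdistrib matrix_mul_assoc)
  also have "\<dots> = Q A ** P B - P A ** Q B"
    using cayley_mult(2)[OF A] cayley_mult(1)[OF B] by (simp add: P_def Q_def)
  also have "\<dots> = A - B"
    by (simp add: P_def Q_def matrix_add_ldistrib matrix_add_rdistrib
        matrix_sub_ldistrib matrix_sub_rdistrib vec_eq_iff)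
  finally have "R A ** (P A ** (cayley A - cayley B) ** P B) ** R B = R A ** (A - B) ** R B"
    by simp
  moreover have "R A ** (P A ** (cayley A - cayley B) ** P B) ** R B =
      (R A ** P A) ** (cayley A - cayley B) ** (P B ** R B)"
    by (simp add: matrix_mul_assoc)
  moreover have "R A ** P A = mat 1" "P B ** R B = mat 1"
    unfolding R_def using matrix_inv inv A B by metis+
  ultimately have "cayley A - cayley B = R A ** (A - B) ** R B"
    by simp
  moreover have "R A = (1 / 2) *\<^sub>R (mat 1 + cayley A)" "R B = (1 / 2) *\<^sub>R (mat 1 + cayley B)"
    using cayley_mult(3) A B by (simp_all add: R_def P_def)
  ultimately show ?thesis
    by (simp add: matrix_scaleR_left matrix_scaleR_right)
qed

text \<open>In the difference formula both outer factors are bounded uniformly, since orthogonal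
  matrices have a fixed norm.\<close>

lemma lipschitz_on_cayley:
  obtains c where "c-lipschitz_on {A :: real ^ 'n ^ 'n. transpose A = - A} cayley"
proof -
  obtain K where K: "K > 0"
    "\<And>(A :: real ^ 'n ^ 'n) (B :: real ^ 'n ^ 'n). norm (A ** B) \<le> norm A * norm B * K"
    using bounded_bilinear.pos_bounded[OF bounded_bilinear_matrix_mult] by blast
  define d where "d = norm (mat 1 :: real ^ 'n ^ 'n) + sqrt (real CARD('n))"
  have d: "norm (mat 1 + cayley A) \<le> d" if "transpose A = - A" for A :: "real ^ 'n ^ 'n"
    unfolding d_def using norm_triangle_ineq[of "mat 1" "cayley A"]
      norm_orthogonal_matrix[OF cayley_mult(4)[OF that]] by simp
  have [simp]: "d \<ge> 0" by (simp add: d_def)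
  have "(d * d * K * K)-lipschitz_on {A :: real ^ 'n ^ 'n. transpose A = - A} cayley"
  proof (rule lipschitz_onI)
    fix A B :: "real ^ 'n ^ 'n"
    assume "A \<in> {A. transpose A = - A}" "B \<in> {A. transpose A = - A}"
    then have A: "transpose A = - A" and B: "transpose B = - B" by auto
    have "norm (cayley A - cayley B) \<le> norm ((mat 1 + cayley A) ** (A - B) ** (mat 1 + cayley B))"
      by (subst cayley_diff[OF A B]) simp
    also have "\<dots> \<le> norm ((mat 1 + cayley A) ** (A - B)) * norm (mat 1 + cayley B) * K"
      by (rule K)
    also have "\<dots> \<le> (norm (mat 1 + cayley A) * norm (A - B) * K) * norm (mat 1 + cayley B) * K"
      using K by (intro mult_right_mono) auto
    also have "\<dots> \<le> (d * norm (A - B) * K) * d * K"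
      using K d A B by (intro mult_mono) auto
    finally show "dist (cayley A) (cayley B) \<le> d * d * K * K * dist A B"
      by (simp add: dist_norm mult_ac)
  qed (use K in simp)
  then show ?thesis by (rule that)
qed

lemma continuous_on_cayley:
  assumes "continuous_on S f" "\<And>x. x \<in> S \<Longrightarrow> transpose (f x) = - f x"
  shows "continuous_on S (\<lambda>x. cayley (f x))"
proof -
  obtain c where "c-lipschitz_on {A :: real ^ 'b ^ 'b. transpose A = - A} cayley"
    by (rule lipschitz_on_cayley)
  from continuous_on_compose2[OF lipschitz_on_continuous_on[OF this] assms(1)] assms(2)
  show ?thesis by auto
qed

text \<open>With \<open>A = f y\<close>, the remainder \<open>cayley A - mat 1 - A\<close> equals
  half of \<open>A ** (cayley A - mat 1)\<close>: a factor linear in \<open>y\<close> times one that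
  tends to \<open>0\<close> by continuity.\<close>

lemma has_derivative_cayley_zero:
  fixes f :: "'a :: real_normed_vector \<Rightarrow> real ^ 'n ^ 'n"
  assumes f: "bounded_linear f" and skew: "\<And>x. transpose (f x) = - f x"
  shows "((\<lambda>x. cayley (f x)) has_derivative f) (at 0)"
proof -
  interpret f: bounded_linear f by fact
  obtain K where K: "K > 0"
    "\<And>(A :: real ^ 'n ^ 'n) (B :: real ^ 'n ^ 'n). norm (A ** B) \<le> norm A * norm B * K"
    using bounded_bilinear.pos_bounded[OF bounded_bilinear_matrix_mult] by blast
  obtain k where k: "\<And>x. norm (f x) \<le> norm x * k"
    using f.bounded by blast
  let ?r = "\<lambda>x. k * norm (cayley (f x) - mat 1) * K"
  have *: "norm (cayley (f y) - cayley (f 0) - f (y - 0)) / norm (y - 0) \<le> ?r y"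
    if "y \<noteq> 0" for y
  proof -
    define A where "A = f y"
    have A: "cayley A - (1 / 2) *\<^sub>R (A ** cayley A) = mat 1 + (1 / 2) *\<^sub>R A"
      using cayley_mult(2)[of A] skew
      by (simp add: A_def matrix_sub_rdistrib matrix_scaleR_left)
    have "cayley A - mat 1 - A = (1 / 2) *\<^sub>R (A ** cayley A) - (1 / 2) *\<^sub>R A"
    proof -
      have "C - I - A = h - (1 / 2) *\<^sub>R A" if "C - h = I + (1 / 2) *\<^sub>R A"
        for C I h :: "real ^ 'n ^ 'n"
        using that unfolding diff_eq_eq by (simp add: vec_eq_iff)
      from this[OF A] show ?thesis .
    qed
    then have "cayley A - mat 1 - A = (1 / 2) *\<^sub>R (A ** (cayley A - mat 1))"
      by (simp add: matrix_sub_ldistrib scaleR_diff_right)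
    then have "norm (cayley A - mat 1 - A) \<le> norm (A ** (cayley A - mat 1))"
      by simp
    also have "\<dots> \<le> norm A * norm (cayley A - mat 1) * K"
      by (rule K)
    also have "\<dots> \<le> (norm y * k) * norm (cayley A - mat 1) * K"
      unfolding A_def using K k by (intro mult_right_mono) auto
    finally show ?thesis
      using that by (simp add: A_def field_simps)
  qed
  have "continuous_on UNIV (\<lambda>x. cayley (f x))"
    using skew by (intro continuous_on_cayley linear_continuous_on f) auto
  then have "((\<lambda>x. cayley (f x)) \<longlongrightarrow> mat 1) (at 0)"
    by (metis UNIV_I cayley_zero continuous_on_def f.zero)
  then have "(?r \<longlongrightarrow> k * norm (mat 1 - mat 1 :: real ^ 'n ^ 'n) * K) (at 0)"
    by (intro tendsto_intros)
  then have "(?r \<longlongrightarrow> 0) (at 0)"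
    by simp
  then show ?thesis
    using f * by (intro has_derivativeI_sandwich[where e = 1 and H = ?r]) auto
qed

subsection \<open>Derivatives through a local parametrization\<close>

text \<open>Continuity on \<open>S\<close> and an invertible derivative at the single point
  \<open>x\<close> make \<open>g\<close> locally surjective. Any choice \<open>k\<close> of
  preimages near \<open>x\<close> is continuous at \<open>g x\<close> by a linear estimate, hence
  has derivative \<open>h'\<close> there, and the chain rule applies to
  \<open>f = (f \<circ> g) \<circ> k\<close>.\<close>

lemma has_derivative_through_parametrization:
  fixes g :: "'a :: euclidean_space \<Rightarrow> 'b :: euclidean_space"
    and f :: "'b \<Rightarrow> 'c :: real_normed_vector"
  assumes S: "open S" "x \<in> S" "continuous_on S g"
    and g: "(g has_derivative g') (at x)"
    and h: "bounded_linear h'" "g' \<circ> h' = id" "h' \<circ> g' = id"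
    and fg: "((\<lambda>u. f (g u)) has_derivative D) (at x)"
  shows "(f has_derivative (\<lambda>v. D (h' v))) (at (g x))"
proof -
  obtain B where B: "B > 0" "\<And>v. norm (h' v) \<le> norm v * B"
    using bounded_linear.pos_bounded[OF h(1)] by blast
  \<comment> \<open>With this tolerance the linearization error, after applying \<open>h'\<close>,
    costs at most half of \<open>norm (u - x)\<close> and can be absorbed.\<close>
  have "1 / (2 * B) > 0" using B by simp
  then obtain d where d: "d > 0"
    "\<And>u. norm (u - x) < d \<Longrightarrow> norm (g u - g x - g' (u - x)) \<le> 1 / (2 * B) * norm (u - x)"
    using g unfolding has_derivative_at_alt by blast
  have near: "norm (u - x) \<le> 2 * B * norm (g u - g x)" if "u \<in> ball x d" for u
  proof -
    have "norm (g u - g x - g' (u - x)) \<le> 1 / (2 * B) * norm (u - x)"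
      using that d(2) by (simp add: dist_norm norm_minus_commute)
    moreover have "norm (g' (u - x)) \<le> norm (g u - g x) + norm (g u - g x - g' (u - x))"
      by norm
    ultimately have "norm (g' (u - x)) \<le> norm (g u - g x) + 1 / (2 * B) * norm (u - x)"
      by linarith
    then have "norm (g' (u - x)) * B \<le> (norm (g u - g x) + 1 / (2 * B) * norm (u - x)) * B"
      using B(1) by (intro mult_right_mono) auto
    also have "\<dots> = B * norm (g u - g x) + norm (u - x) / 2"
      using B(1) by (simp add: field_simps)
    finally have "norm (g' (u - x)) * B \<le> B * norm (g u - g x) + norm (u - x) / 2" .
    moreover have "norm (u - x) \<le> norm (g' (u - x)) * B"
      using B(2)[of "g' (u - x)"] h(3) by (simp add: fun_eq_iff)
    ultimately show ?thesis by linarith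
  qed
  define N where "N = ball x d \<inter> S"
  define T where "T = interior (g ` N)"
  \<comment> \<open>Preimages are taken inside \<open>N\<close>, where the estimate
    \<open>near\<close> is available.\<close>
  define k where "k = (\<lambda>y. SOME u. u \<in> N \<and> g u = y)"
  have "open N" "x \<in> N" using S d by (auto simp: N_def)
  have gx: "g x \<in> T"
    unfolding T_def
    by (rule sussmann_open_mapping[OF S(1,3,2) g h(1,2)])
      (use interior_open[OF \<open>open N\<close>] \<open>x \<in> N\<close> in \<open>auto simp: N_def\<close>)
  have k: "k y \<in> N" "g (k y) = y" if "y \<in> T" for y
  proof -
    have "\<exists>u. u \<in> N \<and> g u = y"
      using that interior_subset unfolding T_def by blast
    from someI_ex[OF this] show "k y \<in> N" "g (k y) = y"
      by (auto simp: k_def)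
  qed
  have k_near: "norm (k y - x) \<le> 2 * B * norm (y - g x)" if "y \<in> T" for y
    using near[of "k y"] k[OF that] by (simp add: N_def)
  from k_near[OF gx] have kx: "k (g x) = x" by simp
  have "eventually (\<lambda>y. y \<in> T) (at (g x))"
    using gx by (intro eventually_at_in_open') (auto simp: T_def)
  then have "eventually (\<lambda>y. norm (k y - x) \<le> 2 * B * norm (y - g x)) (at (g x))"
    by eventually_elim (rule k_near)
  moreover have "((\<lambda>y. 2 * B * norm (y - g x)) \<longlongrightarrow> 2 * B * norm (g x - g x)) (at (g x))"
    by (intro tendsto_intros)
  ultimately have "((\<lambda>y. k y - x) \<longlongrightarrow> 0) (at (g x))"
    by (auto intro: Lim_null_comparison)
  then have "continuous (at (g x)) k"
    unfolding continuous_at kx by (simp add: Lim_null[symmetric])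
  then have "(k has_derivative h') (at (g x))"
    using g h gx k(2) kx by (intro has_derivative_inverse_basic[where f = g and T = T]) (auto simp: T_def)
  from diff_chain_at[OF this] fg
  have "((\<lambda>y. f (g (k y))) has_derivative (\<lambda>v. D (h' v))) (at (g x))"
    by (simp add: kx o_def)
  then show ?thesis
    by (rule has_derivative_transform_within_open[where s = T]) (use gx k(2) in \<open>auto simp: T_def\<close>)
qed

subsection \<open>Independence of the choice of singular value decomposition\<close>

locale sign_symmetric =
  fixes \<Phi> :: "real ^ 'n \<Rightarrow> real ^ 'n"
  assumes symmetric: "permutation_matrix P \<Longrightarrow> \<Phi> (P *v v) = P *v \<Phi> v"
    and signs: "\<Phi> v = sign_vec v * \<Phi> (abs_vec v)"
begin

lemma permute_entries:
  assumes "p permutes UNIV"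
  shows "\<Phi> (\<chi> i. v $ p i) = (\<chi> i. \<Phi> v $ p i)"
proof -
  define P :: "real ^ 'n ^ 'n" where "P = (\<chi> i j. if j = p i then 1 else 0)"
  have "P *v w = (\<chi> i. w $ p i)" for w
    by (simp add: P_def matrix_vector_mult_def vec_eq_iff if_distrib[of "\<lambda>x. x * _"] cong: if_cong)
  moreover have "permutation_matrix P"
    using assms by (auto simp: permutation_matrix_def P_def)
  ultimately show ?thesis
    using symmetric by metis
qed

lemma zero_entry: "v $ i = 0 \<Longrightarrow> \<Phi> v $ i = 0"
  by (subst signs) (simp add: sign_vec_def)

text \<open>Exchanging \<open>i\<close> and \<open>j\<close> fixes \<open>v\<close>, hence also
  \<open>\<Phi> v\<close> by equivariance.\<close>

lemma equal_entries:
  assumes "v $ i = v $ j"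
  shows "\<Phi> v $ i = \<Phi> v $ j"
proof -
  let ?p = "Transposition.transpose i j"
  have "(\<chi> k. v $ ?p k) = v"
    using assms by (auto simp: vec_eq_iff Transposition.transpose_def)
  then have "\<Phi> v = (\<chi> k. \<Phi> v $ ?p k)"
    using permute_entries[of ?p v] by (simp add: permutes_swap_id)
  then show ?thesis
    by (metis transpose_apply_first vec_lambda_beta)
qed

text \<open>Here \<open>W\<close> and \<open>Z\<close> compare the left and right factors of two
  decompositions. Combining the two equations entrywise shows that \<open>W\<close> and
  \<open>Z\<close> can be nonzero at \<open>(i, j)\<close> only if \<open>L $ j = L' $ i\<close>.
  There their entries agree, unless the common value is \<open>0\<close>, where
  \<open>\<Phi>\<close> vanishes too.\<close>

lemma intertwine:
  fixes W Z :: "real ^ 'n ^ 'n"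
  assumes W: "orthogonal_matrix W"
    and nonneg: "\<And>i. 0 \<le> L $ i" "\<And>i. 0 \<le> L' $ i"
    and eq1: "W ** diag L = diag L' ** Z"
    and eq2: "diag L ** transpose Z = transpose W ** diag L'"
  shows "W ** diag (\<Phi> L) = diag (\<Phi> L') ** Z"
proof -
  have e1: "W $ i $ j * L $ j = L' $ i * Z $ i $ j" for i j
    using arg_cong[OF eq1, of "\<lambda>M. M $ i $ j"] by simp
  have e2: "L $ j * Z $ i $ j = W $ i $ j * L' $ i" for i j
    using arg_cong[OF eq2, of "\<lambda>M. M $ j $ i"] by (simp add: transpose_def)
  have support: "L $ j = L' $ i" if "W $ i $ j \<noteq> 0 \<or> Z $ i $ j \<noteq> 0" for i j
  proof -
    have square: "w * l\<^sup>2 = w * k\<^sup>2" if "w * l = k * z" "l * z = w * k" for w z l k :: real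
    proof -
      have "w * l\<^sup>2 = (w * l) * l" by (simp add: power2_eq_square)
      also have "\<dots> = k * (l * z)" unfolding that(1) by simp
      also have "\<dots> = w * k\<^sup>2" unfolding that(2) by (simp add: power2_eq_square)
      finally show ?thesis .
    qed
    have "W $ i $ j * (L $ j)\<^sup>2 = W $ i $ j * (L' $ i)\<^sup>2"
      using e1[of i j] e2[of j i] by (rule square)
    moreover have "Z $ i $ j * (L $ j)\<^sup>2 = Z $ i $ j * (L' $ i)\<^sup>2"
      using square[of "Z $ i $ j" "L $ j" "L' $ i" "W $ i $ j"] e1[of i j] e2[of j i]
      by (simp add: mult.commute)
    ultimately have "(L $ j)\<^sup>2 = (L' $ i)\<^sup>2"
      using that by auto
    then show ?thesis
      using nonneg by (simp add: power2_eq_iff_nonneg)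
  qed
  \<comment> \<open>Some term of the Leibniz expansion is nonzero; its permutation \<open>p\<close>
    meets only nonzero entries of \<open>W\<close>, so \<open>L'\<close> is \<open>L\<close>
    rearranged by \<open>p\<close>.\<close>
  have "det W \<noteq> 0"
    using det_orthogonal_matrix[OF W] by auto
  then obtain p where p: "p permutes UNIV" "(\<Prod>i\<in>UNIV. W $ i $ p i) \<noteq> 0"
    unfolding det_def by (auto elim!: sum.not_neutral_contains_not_neutral)
  then have "L' $ i = L $ p i" for i
    using support[of i "p i"] by auto
  then have "L' = (\<chi> i. L $ p i)"
    by (simp add: vec_eq_iff)
  then have perm: "\<Phi> L' $ i = \<Phi> L $ p i" for i
    using permute_entries[OF p(1)] by simp
  have "W $ i $ j * \<Phi> L $ j = \<Phi> L' $ i * Z $ i $ j" for i j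
  proof (cases "W $ i $ j = 0 \<and> Z $ i $ j = 0")
    case False
    then have "L $ j = L' $ i"
      using support by blast
    moreover have "\<Phi> L' $ i = \<Phi> L $ j"
      using perm[of i] equal_entries[of L "p i" j] \<open>L' $ i = L $ p i\<close> calculation by simp
    moreover have "W $ i $ j = Z $ i $ j" if "L $ j \<noteq> 0"
      using e1[of i j] calculation that by simp
    ultimately show ?thesis
      using zero_entry[of L j] by auto
  qed simp
  then show ?thesis
    by (simp add: vec_eq_iff)
qed

text \<open>Equating the two decompositions of \<open>X\<close> and moving the orthogonal factors
  across puts them in the form of \<open>intertwine\<close>; the same factors are moved back
  afterwards.\<close>

lemma svd_independent:
  assumes "is_svd V L U X" "is_svd V' L' U' X"
  shows "V ** diag (\<Phi> L) ** transpose U = V' ** diag (\<Phi> L') ** transpose U'"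
proof -
  have orth: "orthogonal_matrix V" "orthogonal_matrix U" "orthogonal_matrix V'" "orthogonal_matrix U'"
    and nonneg: "\<And>i. 0 \<le> L $ i" "\<And>i. 0 \<le> L' $ i"
    and X: "X = V ** diag L ** transpose U" "X = V' ** diag L' ** transpose U'"
    using assms by (auto simp: is_svd_def)
  have cancel: "transpose Q ** (Q ** M) = M" "Q ** (transpose Q ** M) = M"
    if "orthogonal_matrix Q" for Q M :: "real ^ 'n ^ 'n"
    using that by (simp_all add: matrix_mul_assoc orthogonal_matrix_def)
  have one: "transpose Q ** Q = mat 1" "Q ** transpose Q = mat 1"
    if "orthogonal_matrix Q" for Q :: "real ^ 'n ^ 'n"
    using that by (simp_all add: orthogonal_matrix_def)
  let ?W = "transpose V' ** V" and ?Z = "transpose U' ** U"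
  have "?W ** diag (\<Phi> L) = diag (\<Phi> L') ** ?Z"
  proof (rule intertwine)
    show "orthogonal_matrix ?W"
      using orth by (simp add: orthogonal_matrix_mul)
    have "?W ** diag L = transpose V' ** X ** U"
      using orth by (simp add: X(1) one flip: matrix_mul_assoc)
    also have "\<dots> = diag L' ** ?Z"
      using orth by (simp add: X(2) cancel flip: matrix_mul_assoc)
    finally show "?W ** diag L = diag L' ** ?Z" .
    have "diag L ** transpose ?Z = transpose V ** X ** U'"
      using orth by (simp add: X(1) cancel matrix_transpose_mul flip: matrix_mul_assoc)
    also have "\<dots> = transpose ?W ** diag L'"
      using orth by (simp add: X(2) one matrix_transpose_mul flip: matrix_mul_assoc)
    finally show "diag L ** transpose ?Z = transpose ?W ** diag L'" .
  qed (use nonneg in auto)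
  then have "V' ** (?W ** diag (\<Phi> L)) ** transpose U = V' ** (diag (\<Phi> L') ** ?Z) ** transpose U"
    by simp
  then show ?thesis
    using orth by (simp add: cancel one flip: matrix_mul_assoc)
qed

lemma spectral_fun_eq:
  assumes "is_svd V L U X"
  shows "spectral_fun \<Phi> X = V ** diag (\<Phi> L) ** transpose U"
  unfolding spectral_fun_def
  by (rule someI2_ex) (use assms svd_independent in blast)+

text \<open>Negative signs of \<open>v\<close> are absorbed into the left factor, which yields a
  genuine singular value decomposition with values \<open>abs_vec v\<close>.\<close>

lemma spectral_fun_signed:
  assumes "orthogonal_matrix V" "orthogonal_matrix U"
  shows "spectral_fun \<Phi> (V ** diag v ** transpose U) = V ** diag (\<Phi> v) ** transpose U"
proof -
  \<comment> \<open>Unlike \<open>sign_vec v\<close>, this has value \<open>1\<close> at zero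
    entries, so that \<open>diag s\<close> is orthogonal.\<close>
  define s :: "real ^ 'n" where "s = (\<chi> i. if v $ i < 0 then - 1 else 1)"
  have "diag s ** diag (abs_vec v) = diag v"
    by (auto simp: vec_eq_iff s_def abs_vec_def diag_component)
  moreover have "diag s ** diag s = mat 1"
    by (auto simp: vec_eq_iff s_def diag_component mat_def)
  then have "orthogonal_matrix (diag s)"
    by (simp add: orthogonal_matrix)
  ultimately have "is_svd (V ** diag s) (abs_vec v) U (V ** diag v ** transpose U)"
    using assms by (auto simp: is_svd_def orthogonal_matrix_mul abs_vec_def simp flip: matrix_mul_assoc)
  moreover have "diag s ** diag (\<Phi> (abs_vec v)) = diag (\<Phi> v)"
  proof -
    have "s $ i * \<Phi> (abs_vec v) $ i = \<Phi> v $ i" for i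
    proof (cases "v $ i = 0")
      case True
      then show ?thesis
        using zero_entry[of v i] zero_entry[of "abs_vec v" i] by (simp add: abs_vec_def)
    next
      case False
      then show ?thesis
        by (subst (2) signs) (simp add: s_def sign_vec_def)
    qed
    then show ?thesis
      by (auto simp: vec_eq_iff diag_component)
  qed
  ultimately show ?thesis
    using spectral_fun_eq by (metis matrix_mul_assoc)
qed

end

subsection \<open>Perturbation of a singular value decomposition\<close>

text \<open>To first order, the orthogonal factors of \<open>diag L + M\<close> are
  \<open>mat 1 + A\<close> and \<open>mat 1 + B\<close> with \<open>A\<close>, \<open>B\<close> skew. The off-diagonal entries \<open>(i, j)\<close> and \<open>(j, i)\<close>
  of \<open>A ** diag L - diag L ** B = M\<close> form a 2 by 2 system for \<open>A\<^sub>i\<^sub>j\<close> and \<open>B\<^sub>i\<^sub>j\<close>, solved below.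
  On the diagonal the division by zero yields the required value \<open>0\<close>.\<close>

definition left_skew :: "real ^ 'n \<Rightarrow> real ^ 'n ^ 'n \<Rightarrow> real ^ 'n ^ 'n" where
  "left_skew L M = (\<chi> i j. (L $ j * M $ i $ j + L $ i * M $ j $ i) / ((L $ j)\<^sup>2 - (L $ i)\<^sup>2))"

definition right_skew :: "real ^ 'n \<Rightarrow> real ^ 'n ^ 'n \<Rightarrow> real ^ 'n ^ 'n" where
  "right_skew L M = (\<chi> i j. (L $ i * M $ i $ j + L $ j * M $ j $ i) / ((L $ j)\<^sup>2 - (L $ i)\<^sup>2))"

lemma transpose_left_skew: "transpose (left_skew L M) = - left_skew L M"
proof -
  \<comment> \<open>For \<open>a = b\<close> both sides are \<open>0\<close>, so the diagonal needs
    no separate case.\<close>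
  have *: "x / (a - b) = - (x / (b - a))" for x a b :: real
    by (metis minus_diff_eq minus_divide_right)
  show ?thesis
    by (simp add: transpose_def left_skew_def vec_eq_iff add.commute) (use * in blast)
qed

lemma transpose_right_skew: "transpose (right_skew L M) = - right_skew L M"
proof -
  have *: "x / (a - b) = - (x / (b - a))" for x a b :: real
    by (metis minus_diff_eq minus_divide_right)
  show ?thesis
    by (simp add: transpose_def right_skew_def vec_eq_iff add.commute) (use * in blast)
qed

lemma bounded_linear_left_skew: "bounded_linear (left_skew L)"
  unfolding linear_conv_bounded_linear[symmetric]
  by (auto intro!: linearI simp: left_skew_def vec_eq_iff algebra_simps add_divide_distrib)

lemma bounded_linear_right_skew: "bounded_linear (right_skew L)"
  unfolding linear_conv_bounded_linear[symmetric]
  by (auto intro!: linearI simp: right_skew_def vec_eq_iff algebra_simps add_divide_distrib)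

text \<open>Taking the identity for \<open>\<psi>\<close> gives the parametrization of the matrices
  near \<open>X\<close>; taking \<open>\<Phi>\<close> gives the corresponding values of the spectral
  function. One derivative computation thus serves both.\<close>

definition perturb ::
  "real ^ 'n \<Rightarrow> real ^ 'n ^ 'n \<Rightarrow> real ^ 'n ^ 'n \<Rightarrow> (real ^ 'n \<Rightarrow> real ^ 'n) \<Rightarrow>
    real ^ 'n ^ 'n \<Rightarrow> real ^ 'n ^ 'n" where
  "perturb L V U \<psi> M =
    (V ** cayley (left_skew L M)) ** diag (\<psi> (L + (\<chi> i. M $ i $ i))) **
      transpose (U ** cayley (right_skew L M))"

text \<open>The product rule, with both Cayley factors equal to \<open>mat 1\<close> at
  \<open>0\<close>. The minus sign comes from transposing the skew matrix on the right.\<close>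

lemma has_derivative_perturb:
  fixes L :: "real ^ 'n"
  assumes "(\<psi> has_derivative \<psi>') (at L)"
  shows "(perturb L V U \<psi> has_derivative
    (\<lambda>M. V ** (left_skew L M ** diag (\<psi> L) + diag (\<psi>' (\<chi> i. M $ i $ i)) -
      diag (\<psi> L) ** right_skew L M) ** transpose U)) (at 0)"
proof -
  note mult = bounded_bilinear.FDERIV[OF bounded_bilinear_matrix_mult]
  note cayley_l = has_derivative_cayley_zero[OF bounded_linear_left_skew transpose_left_skew, of L]
  note cayley_r = has_derivative_cayley_zero[OF bounded_linear_right_skew transpose_right_skew, of L]
  have zero: "left_skew L 0 = 0" "right_skew L 0 = 0" "(\<chi> i. (0 :: real ^ 'n ^ 'n) $ i $ i) = 0"
    by (simp_all add: left_skew_def right_skew_def vec_eq_iff)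
  have "((\<lambda>M :: real ^ 'n ^ 'n. L + (\<chi> i. M $ i $ i)) has_derivative
      (\<lambda>M. 0 + (\<chi> i. M $ i $ i))) (at 0)"
    by (intro has_derivative_add has_derivative_const
        bounded_linear_imp_has_derivative bounded_linear_diagonal)
  then have "((\<lambda>M. \<psi> (L + (\<chi> i. M $ i $ i))) has_derivative (\<lambda>M. \<psi>' (\<chi> i. M $ i $ i))) (at 0)"
    using assms diff_chain_at[of "\<lambda>M. L + (\<chi> i. M $ i $ i)" "\<lambda>M. 0 + (\<chi> i. M $ i $ i)" 0 \<psi> \<psi>']
    by (simp add: o_def zero flip: zero_vec_def)
  note d = bounded_linear.has_derivative[OF bounded_linear_diag this]
  note t = bounded_linear.has_derivative[OF bounded_linear_transpose]
  note der = mult[OF mult[OF mult[OF has_derivative_const[of V] cayley_l] d]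
      t[OF mult[OF has_derivative_const[of U] cayley_r]]]
  show ?thesis
    unfolding perturb_def
    by (rule has_derivative_eq_rhs[OF der])
      (simp add: fun_eq_iff zero zero_vec_def[symmetric] matrix_transpose_mul transpose_right_skew matrix_add_ldistrib
        matrix_add_rdistrib matrix_sub_ldistrib matrix_sub_rdistrib matrix_mul_assoc
        bounded_bilinear.minus_left[OF bounded_bilinear_matrix_mult]
        bounded_bilinear.minus_right[OF bounded_bilinear_matrix_mult])
qed

lemma continuous_on_perturb_id: "continuous_on UNIV (perturb L V U (\<lambda>v. v))"
proof -
  note mult = bounded_bilinear.continuous_on[OF bounded_bilinear_matrix_mult]
  show ?thesis
    unfolding perturb_def
    by (intro mult continuous_on_const continuous_on_add continuous_on_cayley
        bounded_linear.continuous_on[OF bounded_linear_diag]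
        bounded_linear.continuous_on[OF bounded_linear_transpose]
        linear_continuous_on bounded_linear_diagonal bounded_linear_left_skew
        bounded_linear_right_skew transpose_left_skew transpose_right_skew)
qed

section \<open>The derivative at \<open>0\<close> when the entries of \<open>L\<close> are distinct
  and nonnegative\<close>

lemma distinct_nonneg:
  fixes a b :: real
  assumes "0 \<le> a" "0 \<le> b" "a \<noteq> b"
  shows "0 < a + b" and "b\<^sup>2 - a\<^sup>2 \<noteq> 0"
  using assms by (auto simp: power2_eq_iff_nonneg)

text \<open>This is the linear system that the two skew matrices were chosen to solve: the
  parametrization has derivative \<open>M \<mapsto> V ** M ** transpose U\<close> at
  \<open>0\<close>.\<close>

lemma skew_equation:
  assumes "\<And>i. 0 \<le> L $ i" "\<And>i j. i \<noteq> j \<Longrightarrow> L $ i \<noteq> L $ j"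
  shows "left_skew L M ** diag L + diag (\<chi> i. M $ i $ i) - diag L ** right_skew L M = M"
proof -
  \<comment> \<open>The entry \<open>(i, j)\<close> off the diagonal, with \<open>k = L $ i\<close>,
    \<open>l = L $ j\<close>, \<open>m = M $ i $ j\<close> and
    \<open>m' = M $ j $ i\<close>.\<close>
  have "(l * m + k * m') / (l\<^sup>2 - k\<^sup>2) * l - k * ((k * m + l * m') / (l\<^sup>2 - k\<^sup>2)) = m"
    if "l\<^sup>2 - k\<^sup>2 \<noteq> 0" for k l m m' :: real
    using that by (simp add: divide_simps) (simp add: power2_eq_square algebra_simps)
  then show ?thesis
    using distinct_nonneg(2)[OF assms(1,1) assms(2)]
    by (auto simp: vec_eq_iff left_skew_def right_skew_def diag_component)
qed

text \<open>Off the diagonal, splitting \<open>M\<close> into symmetric and antisymmetric parts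
  decomposes the coefficients with denominator \<open>(L $ j)\<^sup>2 - (L $ i)\<^sup>2\<close> into
  partial fractions, which are the quotients in \<open>Gamma_S\<close> and
  \<open>Gamma_A\<close>.\<close>

lemma skew_Gamma:
  assumes "\<And>i. 0 \<le> L $ i" "\<And>i j. i \<noteq> j \<Longrightarrow> L $ i \<noteq> L $ j"
  shows "left_skew L M ** diag (\<Phi> L) + diag (frechet_derivative \<Phi> (at L) (\<chi> i. M $ i $ i)) -
      diag (\<Phi> L) ** right_skew L M =
    M_diag \<Phi> L M + Gamma_S \<Phi> L * P_S M + Gamma_A \<Phi> L * P_A M"
proof -
  have *: "(l * m + k * m') / (l\<^sup>2 - k\<^sup>2) * q - p * ((k * m + l * m') / (l\<^sup>2 - k\<^sup>2)) =
      (p - q) / (k - l) * ((m + m') / 2) + (p + q) / (k + l) * ((m - m') / 2)"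
    if "k + l \<noteq> 0" "k \<noteq> l" for k l m m' p q :: real
  proof -
    have "l\<^sup>2 - k\<^sup>2 = - ((k - l) * (k + l))"
      by (simp add: power2_eq_square algebra_simps)
    with that show ?thesis
      by (simp add: divide_simps) (simp add: algebra_simps)
  qed
  have "(left_skew L M ** diag (\<Phi> L) - diag (\<Phi> L) ** right_skew L M) $ i $ j =
      (Gamma_S \<Phi> L * P_S M + Gamma_A \<Phi> L * P_A M) $ i $ j" for i j
  proof (cases "i = j")
    case True
    then show ?thesis
      by (simp add: left_skew_def right_skew_def Gamma_S_def Gamma_A_def)
  next
    case False
    have pos: "0 < L $ i + L $ j"
      using distinct_nonneg(1)[OF assms(1,1) assms(2)[OF False]] .
    \<comment> \<open>This selects the quotient in \<open>Gamma_A\<close>; distinctness selects the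
      one in \<open>Gamma_S\<close>.\<close>
    then have "0 < L $ i \<or> 0 < L $ j" by linarith
    with pos show ?thesis
      using False assms(2)[OF False] *[of "L $ i" "L $ j"]
      by (simp add: left_skew_def right_skew_def Gamma_S_def Gamma_A_def P_S_def P_A_def)
  qed
  then have "left_skew L M ** diag (\<Phi> L) - diag (\<Phi> L) ** right_skew L M =
      Gamma_S \<Phi> L * P_S M + Gamma_A \<Phi> L * P_A M"
    by (simp add: vec_eq_iff)
  then show ?thesis
    by (simp add: M_diag_def algebra_simps)
qed

section \<open>Transfer of differentiability between \<open>\<Phi>\<close> and its spectral
  function\<close>

context sign_symmetric
begin

text \<open>The Cayley factors are orthogonal. The signed version is essential, because
  \<open>L + (\<chi> i. M $ i $ i)\<close> may have negative entries, even for small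
  \<open>M\<close> if \<open>L\<close> has a zero entry.\<close>

lemma spectral_fun_perturb:
  assumes "orthogonal_matrix V" "orthogonal_matrix U"
  shows "spectral_fun \<Phi> (perturb L V U (\<lambda>v. v) M) = perturb L V U \<Phi> M"
  unfolding perturb_def
  by (intro spectral_fun_signed orthogonal_matrix_mul assms cayley_mult(4)
      transpose_left_skew transpose_right_skew)

text \<open>Along the parametrization by \<open>perturb\<close> the spectral function has derivative
  \<open>D\<close> at \<open>0\<close>, and the derivative of the parametrization is inverted by
  \<open>\<delta> \<mapsto> transpose V ** \<delta> ** U\<close>.\<close>

lemma has_derivative_spectral_fun:
  assumes svd: "is_svd V L U X"
    and distinct: "\<And>i j. i \<noteq> j \<Longrightarrow> L $ i \<noteq> L $ j"
    and diff: "\<Phi> differentiable (at L)"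
  defines "D \<equiv> \<lambda>M. V ** (M_diag \<Phi> L M + Gamma_S \<Phi> L * P_S M + Gamma_A \<Phi> L * P_A M) ** transpose U"
  shows "(spectral_fun \<Phi> has_derivative (\<lambda>\<delta>. D (transpose V ** \<delta> ** U))) (at X)"
proof -
  have V: "orthogonal_matrix V" and U: "orthogonal_matrix U" and nonneg: "\<And>i. 0 \<le> L $ i"
    and X: "X = V ** diag L ** transpose U"
    using svd by (auto simp: is_svd_def)
  have cancel: "transpose Q ** (Q ** M) = M" "Q ** (transpose Q ** M) = M"
    "transpose Q ** Q = mat 1" "Q ** transpose Q = mat 1"
    if "orthogonal_matrix Q" for Q M :: "real ^ 'n ^ 'n"
    using that by (simp_all add: matrix_mul_assoc orthogonal_matrix_def)
  have "left_skew L 0 = 0" "right_skew L 0 = 0" "(\<chi> i. (0 :: real ^ 'n ^ 'n) $ i $ i) = 0"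
    by (simp_all add: left_skew_def right_skew_def vec_eq_iff)
  then have perturb_0: "perturb L V U (\<lambda>v. v) 0 = X"
    by (simp add: perturb_def X)
  have "(perturb L V U (\<lambda>v. v) has_derivative (\<lambda>M. V ** M ** transpose U)) (at 0)"
    using has_derivative_perturb[OF has_derivative_ident, of L V U]
    by (simp add: skew_equation[OF nonneg distinct])
  moreover have "((\<lambda>M. spectral_fun \<Phi> (perturb L V U (\<lambda>v. v) M)) has_derivative D) (at 0)"
    using has_derivative_perturb[OF diff[unfolded frechet_derivative_works], of V U]
    by (simp add: spectral_fun_perturb[OF V U] skew_Gamma[OF nonneg distinct] D_def)
  moreover have "bounded_linear (\<lambda>\<delta>. transpose V ** \<delta> ** U)"
    using bounded_linear_compose[OF
        bounded_bilinear.bounded_linear_left[OF bounded_bilinear_matrix_mult]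
        bounded_bilinear.bounded_linear_right[OF bounded_bilinear_matrix_mult]] .
  moreover have "(\<lambda>M. V ** M ** transpose U) \<circ> (\<lambda>\<delta>. transpose V ** \<delta> ** U) = id"
    "(\<lambda>\<delta>. transpose V ** \<delta> ** U) \<circ> (\<lambda>M. V ** M ** transpose U) = id"
    using V U by (simp_all add: fun_eq_iff cancel flip: matrix_mul_assoc)
  ultimately show ?thesis
    using has_derivative_through_parametrization[OF open_UNIV UNIV_I continuous_on_perturb_id]
    unfolding perturb_0[symmetric] by blast
qed

text \<open>The identity \<open>\<Phi> = g \<circ> spectral_fun \<Phi> \<circ> f\<close> holds for
  vectors of all signs, with \<open>f\<close> and \<open>g\<close> linear: \<open>f\<close> inserts
  a vector between the fixed factors \<open>V\<close> and \<open>U\<close>, and \<open>g\<close>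
  reads it off again.\<close>

lemma differentiable_if_spectral_fun_differentiable:
  assumes svd: "is_svd V L U X"
    and diff: "spectral_fun \<Phi> differentiable (at X)"
  shows "\<Phi> differentiable (at L)"
proof -
  have V: "orthogonal_matrix V" and U: "orthogonal_matrix U"
    and X: "X = V ** diag L ** transpose U"
    using svd by (auto simp: is_svd_def)
  have lin: "bounded_linear (\<lambda>M. A ** M ** B)" for A B :: "real ^ 'n ^ 'n"
    using bounded_linear_compose[OF
        bounded_bilinear.bounded_linear_left[OF bounded_bilinear_matrix_mult]
        bounded_bilinear.bounded_linear_right[OF bounded_bilinear_matrix_mult]] .
  define f where "f = (\<lambda>v. V ** diag v ** transpose U)"
  define g where "g = (\<lambda>M :: real ^ 'n ^ 'n. \<chi> i. (transpose V ** M ** U) $ i $ i)"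
  have "bounded_linear f"
    unfolding f_def by (rule bounded_linear_compose[OF lin bounded_linear_diag])
  moreover have "bounded_linear g"
    unfolding g_def by (rule bounded_linear_compose[OF bounded_linear_diagonal lin])
  ultimately have "(g \<circ> spectral_fun \<Phi> \<circ> f) differentiable (at L)"
    using diff X unfolding f_def[symmetric] o_assoc[symmetric]
    by (metis (no_types) bounded_linear_imp_differentiable comp_apply differentiable_chain_at f_def)
  moreover have "g \<circ> spectral_fun \<Phi> \<circ> f = \<Phi>"
  proof
    fix v
    have "transpose V ** (V ** diag (\<Phi> v) ** transpose U) ** U =
        (transpose V ** V) ** diag (\<Phi> v) ** (transpose U ** U)"
      by (simp add: matrix_mul_assoc)
    also have "\<dots> = diag (\<Phi> v)"
      using V U by (simp add: orthogonal_matrix_def)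
    finally show "(g \<circ> spectral_fun \<Phi> \<circ> f) v = \<Phi> v"
      by (simp add: f_def g_def spectral_fun_signed[OF V U] diag_component vec_eq_iff)
  qed
  ultimately show ?thesis by simp
qed

end

theorem theorem1:
  fixes \<Phi> :: "real ^ 'n \<Rightarrow> real ^ 'n"
    and X V U :: "real ^ 'n ^ 'n" and L :: "real ^ 'n"
  assumes symmetric: "\<And>P v. permutation_matrix P \<Longrightarrow> \<Phi> (P *v v) = P *v \<Phi> v"
    and signs: "\<And>v. \<Phi> v = sign_vec v * \<Phi> (abs_vec v)"
    and svd: "is_svd V L U X"
    and distinct: "\<And>i j. i \<noteq> j \<Longrightarrow> L $ i \<noteq> L $ j"
  shows "(spectral_fun \<Phi> differentiable (at X) \<longleftrightarrow> \<Phi> differentiable (at L)) \<and>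
    (\<Phi> differentiable (at L) \<longrightarrow>
      (\<forall>\<delta>. frechet_derivative (spectral_fun \<Phi>) (at X) \<delta> =
        (let \<delta>' = transpose V ** \<delta> ** U in
          V ** (M_diag \<Phi> L \<delta>' + Gamma_S \<Phi> L * P_S \<delta>' + Gamma_A \<Phi> L * P_A \<delta>') ** transpose U)))"
proof -
  interpret sign_symmetric \<Phi>
    by unfold_locales (fact symmetric, fact signs)
  \<comment> \<open>Uniqueness of the derivative turns this into the formula for
    \<open>frechet_derivative\<close>.\<close>
  note der = has_derivative_spectral_fun[OF svd distinct]
  show ?thesis
    using differentiable_if_spectral_fun_differentiable[OF svd] der
      frechet_derivative_at[OF der]
    by (auto simp: differentiable_def Let_def fun_eq_iff)
qed

end
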